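(* Let $f$ be a positive operator monotone function on $(-\infty,0)$ and let $A,B$ be negative invertible operators on a complex Hilbert space. Then $$f(A+B)\leq f(A)+f(B)$$ if and only if $$A(\lambda-B)^{-1}A+B(\lambda-A)^{-1}B\geq 0\quad\text{for every }\lambda\in[0,\infty).$$
   Context: Operators are bounded linear operators on a complex Hilbert space $\mathcal{H}$. $A\ge 0$ (positive) means $\langle Ax,x\rangle\ge 0$ for all $x\in\mathcal{H}$; $A$ is negative if $-A$ is positive; for self-adjoint $A,B$, $A\le B$ means $B-A\ge 0$. For a scalar $\lambda$, $\lambda-A$ means $\lambda I-A$. $f(A)$ denotes the continuous functional calculus. A continuous real-valued function $f$ on an interval $J$ is operator monotone if $A\le B$ implies $f(A)\le f(B)$ for all self-adjoint operators $A,B$ (on any complex Hilbert space) with spectra in $J$. A positive function is one with $f(t)>0$ for all $t$ in its domain. *)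

theory Defs
  imports "HOL-Analysis.Analysis" "HOL-Algebra.Module"
begin

section \<open>Complex Hilbert spaces\<close>

text \<open>
  Operator monotonicity quantifies over Hilbert spaces, so these are represented as records with
  an explicit carrier. A Hilbert space extends the record of modules over \<open>complex_ring\<close>; the
  fields \<open>mult\<close> and \<open>one\<close>, which that record inherits from rings, play no role.
\<close>

definition complex_ring :: "complex ring" where
  "complex_ring = \<lparr>carrier = UNIV, mult = (*), one = 1, zero = 0, add = (+)\<rparr>"

record 'a hilbert = "(complex, 'a) module" +
  hinner :: "'a \<Rightarrow> 'a \<Rightarrow> complex"

definition hnorm :: "('a, 'm) hilbert_scheme \<Rightarrow> 'a \<Rightarrow> real" where
  "hnorm H x = sqrt (Re (hinner H x x))"

text \<open>The inner product is linear in its first argument.\<close>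

locale complex_hilbert_space = Module.module complex_ring H
  for H :: "('a, 'm) hilbert_scheme" (structure) +
  assumes hinner_add_left:
      "\<lbrakk>x \<in> carrier H; y \<in> carrier H; z \<in> carrier H\<rbrakk>
        \<Longrightarrow> hinner H (x \<oplus> y) z = hinner H x z + hinner H y z"
    and hinner_smult_left:
      "\<lbrakk>x \<in> carrier H; y \<in> carrier H\<rbrakk> \<Longrightarrow> hinner H (c \<odot> x) y = c * hinner H x y"
    and hinner_commute:
      "\<lbrakk>x \<in> carrier H; y \<in> carrier H\<rbrakk> \<Longrightarrow> hinner H x y = cnj (hinner H y x)"
    and hinner_nonneg: "x \<in> carrier H \<Longrightarrow> hinner H x x \<in> \<real>\<^sub>\<ge>\<^sub>0"
    and hinner_definite: "\<lbrakk>x \<in> carrier H; hinner H x x = 0\<rbrakk> \<Longrightarrow> x = \<zero>"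
    and complete:
      "\<lbrakk>\<And>n. s n \<in> carrier H;
        \<And>e. e > 0 \<Longrightarrow> \<exists>N. \<forall>m\<ge>N. \<forall>n\<ge>N. hnorm H (s m \<ominus> s n) < e\<rbrakk>
        \<Longrightarrow> \<exists>x\<in>carrier H. (\<lambda>n. hnorm H (s n \<ominus> x)) \<longlonglongrightarrow> 0"


section \<open>The algebra of bounded operators\<close>

text \<open>Operators are extensional on the carrier, so that equality of operators is equality in HOL.\<close>

definition bounded_op :: "('a, 'm) hilbert_scheme \<Rightarrow> ('a \<Rightarrow> 'a) \<Rightarrow> bool" where
  "bounded_op H T \<longleftrightarrow>
     T \<in> carrier H \<rightarrow>\<^sub>E carrier H \<and>
     (\<forall>x\<in>carrier H. \<forall>y\<in>carrier H. T (x \<oplus>\<^bsub>H\<^esub> y) = T x \<oplus>\<^bsub>H\<^esub> T y) \<and>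
     (\<forall>c. \<forall>x\<in>carrier H. T (c \<odot>\<^bsub>H\<^esub> x) = c \<odot>\<^bsub>H\<^esub> T x) \<and>
     (\<exists>K. \<forall>x\<in>carrier H. hnorm H (T x) \<le> K * hnorm H x)"

definition bounded_ops :: "('a, 'm) hilbert_scheme \<Rightarrow> (complex, 'a \<Rightarrow> 'a) module" where
  "bounded_ops H =
     \<lparr>carrier = {T. bounded_op H T},
      mult = compose (carrier H),
      one = (\<lambda>x\<in>carrier H. x),
      zero = (\<lambda>x\<in>carrier H. \<zero>\<^bsub>H\<^esub>),
      add = (\<lambda>S T. \<lambda>x\<in>carrier H. S x \<oplus>\<^bsub>H\<^esub> T x),
      smult = (\<lambda>c T. \<lambda>x\<in>carrier H. c \<odot>\<^bsub>H\<^esub> T x)\<rparr>"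

text \<open>The operator \<open>\<lambda> - T\<close>, that is \<open>\<lambda> I - T\<close>.\<close>

definition scalar_minus :: "('a, 'm) hilbert_scheme \<Rightarrow> complex \<Rightarrow> ('a \<Rightarrow> 'a) \<Rightarrow> ('a \<Rightarrow> 'a)" where
  "scalar_minus H c T =
     (c \<odot>\<^bsub>bounded_ops H\<^esub> \<one>\<^bsub>bounded_ops H\<^esub>) \<ominus>\<^bsub>bounded_ops H\<^esub> T"

definition spectrum :: "('a, 'm) hilbert_scheme \<Rightarrow> ('a \<Rightarrow> 'a) \<Rightarrow> complex set" where
  "spectrum H T = {z. scalar_minus H z T \<notin> Units (bounded_ops H)}"

text \<open>\<open>S\<close> is the adjoint of \<open>T\<close>.\<close>

definition is_adjoint :: "('a, 'm) hilbert_scheme \<Rightarrow> ('a \<Rightarrow> 'a) \<Rightarrow> ('a \<Rightarrow> 'a) \<Rightarrow> bool" where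
  "is_adjoint H T S \<longleftrightarrow>
     (\<forall>x\<in>carrier H. \<forall>y\<in>carrier H. hinner H (T x) y = hinner H x (S y))"

definition self_adjoint :: "('a, 'm) hilbert_scheme \<Rightarrow> ('a \<Rightarrow> 'a) \<Rightarrow> bool" where
  "self_adjoint H T \<longleftrightarrow> bounded_op H T \<and> is_adjoint H T T"

definition positive_op :: "('a, 'm) hilbert_scheme \<Rightarrow> ('a \<Rightarrow> 'a) \<Rightarrow> bool" where
  "positive_op H T \<longleftrightarrow> bounded_op H T \<and> (\<forall>x\<in>carrier H. hinner H (T x) x \<in> \<real>\<^sub>\<ge>\<^sub>0)"

definition negative_op :: "('a, 'm) hilbert_scheme \<Rightarrow> ('a \<Rightarrow> 'a) \<Rightarrow> bool" where
  "negative_op H T \<longleftrightarrow> bounded_op H T \<and> positive_op H (\<ominus>\<^bsub>bounded_ops H\<^esub> T)"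

definition op_le :: "('a, 'm) hilbert_scheme \<Rightarrow> ('a \<Rightarrow> 'a) \<Rightarrow> ('a \<Rightarrow> 'a) \<Rightarrow> bool" where
  "op_le H S T \<longleftrightarrow> positive_op H (T \<ominus>\<^bsub>bounded_ops H\<^esub> S)"


section \<open>Continuous functional calculus\<close>

text \<open>
  \<open>\<Phi>\<close> is a unital *-homomorphism from the continuous functions on the spectrum of \<open>T\<close> to the
  bounded operators that maps the identity function to \<open>T\<close>. A function on the spectrum is given
  by any extension to \<open>\<complex>\<close>, which is why \<open>\<Phi>\<close> has to respect equality on the spectrum.
  Contractivity need not be required: every such \<open>\<Phi>\<close> has it. Hence for self-adjoint (and for
  normal) \<open>T\<close> there is exactly one \<open>\<Phi>\<close>, up to its values at functions that are not continuous
  on the spectrum.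
\<close>

definition cfc_hom ::
  "('a, 'm) hilbert_scheme \<Rightarrow> ('a \<Rightarrow> 'a) \<Rightarrow> ((complex \<Rightarrow> complex) \<Rightarrow> ('a \<Rightarrow> 'a)) \<Rightarrow> bool" where
  "cfc_hom H T \<Phi> \<longleftrightarrow>
    (let C = {g. continuous_on (spectrum H T) g} in
      (\<forall>g\<in>C. \<Phi> g \<in> carrier (bounded_ops H)) \<and>
      (\<forall>g\<in>C. \<forall>h\<in>C. (\<forall>z\<in>spectrum H T. g z = h z) \<longrightarrow> \<Phi> g = \<Phi> h) \<and>
      (\<forall>g\<in>C. \<forall>h\<in>C. \<Phi> (\<lambda>z. g z + h z) = \<Phi> g \<oplus>\<^bsub>bounded_ops H\<^esub> \<Phi> h) \<and>
      (\<forall>g\<in>C. \<forall>h\<in>C. \<Phi> (\<lambda>z. g z * h z) = \<Phi> g \<otimes>\<^bsub>bounded_ops H\<^esub> \<Phi> h) \<and>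
      (\<forall>c. \<forall>g\<in>C. \<Phi> (\<lambda>z. c * g z) = c \<odot>\<^bsub>bounded_ops H\<^esub> \<Phi> g) \<and>
      (\<forall>g\<in>C. is_adjoint H (\<Phi> g) (\<Phi> (\<lambda>z. cnj (g z)))) \<and>
      \<Phi> (\<lambda>z. 1) = \<one>\<^bsub>bounded_ops H\<^esub> \<and>
      \<Phi> (\<lambda>z. z) = T)"

definition cfc :: "('a, 'm) hilbert_scheme \<Rightarrow> (complex \<Rightarrow> complex) \<Rightarrow> ('a \<Rightarrow> 'a) \<Rightarrow> ('a \<Rightarrow> 'a)" where
  "cfc H g T = (THE S. \<exists>\<Phi>. cfc_hom H T \<Phi> \<and> S = \<Phi> g)"

text \<open>\<open>f(T)\<close> for self-adjoint \<open>T\<close>, whose spectrum is real, and a function \<open>f\<close> of a real variable.\<close>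

definition real_cfc :: "('a, 'm) hilbert_scheme \<Rightarrow> (real \<Rightarrow> real) \<Rightarrow> ('a \<Rightarrow> 'a) \<Rightarrow> ('a \<Rightarrow> 'a)" where
  "real_cfc H f T = cfc H (\<lambda>z. complex_of_real (f (Re z))) T"


section \<open>Operator monotone functions\<close>

text \<open>
  HOL cannot quantify over types inside a formula, so the Hilbert spaces considered are all those
  whose carrier is a set of elements of the type \<open>'a\<close>. This is no restriction when \<open>'a\<close> carries
  a Hilbert space other than \<open>0\<close>: then \<open>'a\<close> has at least the cardinality of the continuum,
  hence carries copies of \<open>\<complex>\<^sup>n\<close> for every \<open>n\<close>, and monotonicity for matrices of every size implies
  monotonicity on every Hilbert space.
\<close>

definition operator_monotone :: "'a itself \<Rightarrow> real set \<Rightarrow> (real \<Rightarrow> real) \<Rightarrow> bool" where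
  "operator_monotone (_ :: 'a itself) J f \<longleftrightarrow>
     is_interval J \<and> continuous_on J f \<and>
     (\<forall>(H :: 'a hilbert) A B.
        complex_hilbert_space H \<and> self_adjoint H A \<and> self_adjoint H B \<and>
        spectrum H A \<subseteq> complex_of_real ` J \<and> spectrum H B \<subseteq> complex_of_real ` J \<and>
        op_le H A B \<longrightarrow> op_le H (real_cfc H f A) (real_cfc H f B))"

end

theory Submission
  imports Defs
begin

text \<open>
  Both sides of the equivalence hold for all negative invertible \<open>A\<close> and
  \<open>B\<close>, and each is proved outright.

  The resolvent condition. A negative invertible operator is bounded away from zero: its quadratic
  form is at most \<open>- d \<parallel>x\<parallel>\<^sup>2\<close> for some \<open>d > 0\<close>
  (\<open>negative_unit_imp_strictly_negative\<close>). Such an operator has its spectrum in the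
  negative half-line, because \<open>z - T\<close> is coercive, hence invertible, for every other
  \<open>z\<close> (\<open>coercive_imp_unit\<close>, \<open>strictly_negative_resolvent\<close>).
  For \<open>\<lambda> \<ge> 0\<close> the operator \<open>\<lambda> - B\<close> is moreover
  positive, so its inverse is positive, and so is \<open>A (\<lambda> - B)\<^sup>-\<^sup>1
  A\<close> (\<open>positive_sandwich_resolvent\<close>). The condition asks that a sum of two
  such operators be positive.

  Subadditivity. From \<open>A + B \<le> A\<close> operator monotonicity gives \<open>f(A + B)
  \<le> f(A)\<close>, so that it is enough to know that \<open>f(B) \<ge> 0\<close>. This again
  follows from monotonicity: \<open>B\<close> lies above some negative multiple \<open>t I\<close>
  of the identity, and \<open>f(t I) = f(t) I\<close> is positive, so \<open>0 \<le> f(t) I \<le>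
  f(B)\<close>. Only the functional calculus of the multiples of the identity has to be computed
  (\<open>cfc_scalar_op\<close>).

  The term \<open>f(T)\<close> is a definite description, which by itself need not denote an
  operator. That it does is also read off from monotonicity (\<open>real_cfc_lower_bound\<close>).
  The hypothesis on \<open>f\<close> concerns every Hilbert space on the underlying type, in
  particular the space that differs from \<open>H\<close> only in sending sums with a summand
  outside the carrier to a point outside the carrier. The calculus is the same there, but on that
  space \<open>f(t) I \<le> f(T)\<close> can hold only if \<open>f(T)\<close> maps the carrier
  into itself; and then \<open>f(T)\<close> is the sum of \<open>f(t) I\<close> and of a positive
  bounded operator.
\<close>


section \<open>Geometry of a complex Hilbert space\<close>

lemma complex_ring_simps [simp]:
  "carrier complex_ring = UNIV"
  "add complex_ring = (+)"
  "mult complex_ring = (*)"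
  "one complex_ring = 1"
  "zero complex_ring = 0"
  by (simp_all add: complex_ring_def)

context complex_hilbert_space
begin

lemma hinner_add_right:
  assumes "x \<in> carrier H" "y \<in> carrier H" "z \<in> carrier H"
  shows "hinner H x (y \<oplus> z) = hinner H x y + hinner H x z"
  using assms hinner_add_left[of y z x]
  by (metis M.add.m_closed complex_cnj_add hinner_commute)

lemma hinner_smult_right:
  assumes "x \<in> carrier H" "y \<in> carrier H"
  shows "hinner H x (c \<odot> y) = cnj c * hinner H x y"
  using assms hinner_smult_left[of y x c] hinner_commute[of x "c \<odot> y"] hinner_commute[of x y]
  by simp

lemma hinner_zero_left: "x \<in> carrier H \<Longrightarrow> hinner H \<zero> x = 0"
  using hinner_smult_left[of \<zero> x 0] by simp

lemma hinner_zero_right: "x \<in> carrier H \<Longrightarrow> hinner H x \<zero> = 0"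
  using hinner_smult_right[of x \<zero> 0] by simp

lemma hinner_minus_left:
  assumes "x \<in> carrier H" "y \<in> carrier H"
  shows "hinner H (\<ominus> x) y = - hinner H x y"
  using hinner_add_left[of "\<ominus> x" x y] hinner_zero_left[of y] assms
  by (simp add: M.l_neg eq_neg_iff_add_eq_0)

lemma hinner_minus_right:
  assumes "x \<in> carrier H" "y \<in> carrier H"
  shows "hinner H x (\<ominus> y) = - hinner H x y"
  using hinner_add_right[of x "\<ominus> y" y] hinner_zero_right[of x] assms
  by (simp add: M.l_neg eq_neg_iff_add_eq_0)

lemmas hinner_simps = hinner_add_left hinner_add_right hinner_smult_left hinner_smult_right
  hinner_zero_left hinner_zero_right hinner_minus_left hinner_minus_right M.minus_eq

lemma hinner_self:
  assumes "x \<in> carrier H"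
  shows "hinner H x x = complex_of_real ((hnorm H x)\<^sup>2)"
  using hinner_nonneg[OF assms]
  by (simp add: hnorm_def complex_nonneg_Reals_iff complex_eq_iff)

lemma hnorm_nonneg: "x \<in> carrier H \<Longrightarrow> 0 \<le> hnorm H x"
  using hinner_nonneg[of x] by (simp add: hnorm_def complex_nonneg_Reals_iff)

lemma hnorm_eq_0_iff: "x \<in> carrier H \<Longrightarrow> hnorm H x = 0 \<longleftrightarrow> x = \<zero>"
  using hinner_self[of x] hinner_definite[of x] by (auto simp: hnorm_def hinner_zero_left)

lemma Re_hinner_commute:
  "x \<in> carrier H \<Longrightarrow> y \<in> carrier H \<Longrightarrow> Re (hinner H x y) = Re (hinner H y x)"
  using hinner_commute[of x y] by simp

lemma hnorm_add_sq:
  assumes "x \<in> carrier H" "y \<in> carrier H"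
  shows "(hnorm H (x \<oplus> y))\<^sup>2 = (hnorm H x)\<^sup>2 + 2 * Re (hinner H x y) + (hnorm H y)\<^sup>2"
proof -
  have "Re (hinner H (x \<oplus> y) (x \<oplus> y)) =
    Re (hinner H x x) + 2 * Re (hinner H x y) + Re (hinner H y y)"
    using assms Re_hinner_commute[of x y] by (simp add: hinner_simps)
  thus ?thesis using assms by (simp add: hinner_self)
qed

lemma hnorm_smult:
  assumes "x \<in> carrier H"
  shows "hnorm H (c \<odot> x) = cmod c * hnorm H x"
proof -
  have "hinner H (c \<odot> x) (c \<odot> x) = c * cnj c * hinner H x x"
    using assms by (simp add: hinner_simps)
  also have "\<dots> = complex_of_real ((cmod c * hnorm H x)\<^sup>2)"
    using assms by (simp add: hinner_self power_mult_distrib flip: complex_norm_square)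
  finally have "Re (hinner H (c \<odot> x) (c \<odot> x)) = (cmod c * hnorm H x)\<^sup>2" by simp
  thus ?thesis using assms hnorm_nonneg[of x] by (simp add: hnorm_def[of H "c \<odot> x"])
qed

lemma hnorm_minus: "x \<in> carrier H \<Longrightarrow> hnorm H (\<ominus> x) = hnorm H x"
  by (simp add: hnorm_def hinner_simps)

text \<open>
  Expand the square of the norm of \<open>\<parallel>y\<parallel> x - \<parallel>x\<parallel>
  y\<close>. The real part is all that the triangle inequality and the estimates of quadratic
  forms require.
\<close>

lemma Cauchy_Schwarz_Re:
  assumes "x \<in> carrier H" "y \<in> carrier H"
  shows "Re (hinner H x y) \<le> hnorm H x * hnorm H y"
proof (cases "hnorm H y = 0")
  case True
  thus ?thesis using assms by (simp add: hnorm_eq_0_iff[of y] hinner_zero_right hnorm_nonneg)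
next
  case False
  hence y: "hnorm H y > 0" using hnorm_nonneg assms by force
  show ?thesis
  proof (cases "hnorm H x = 0")
    case True
    thus ?thesis using assms by (simp add: hnorm_eq_0_iff[of x] hinner_zero_left hnorm_nonneg)
  next
    case False
    hence x: "hnorm H x > 0" using hnorm_nonneg assms by force
    let ?a = "hnorm H x" and ?b = "hnorm H y" and ?r = "Re (hinner H x y)"
    let ?u = "complex_of_real ?b \<odot> x" and ?v = "complex_of_real (- ?a) \<odot> y"
    have "0 \<le> (hnorm H (?u \<oplus> ?v))\<^sup>2" by simp
    also have "\<dots> = 2 * (?a * ?b) * (?a * ?b - ?r)"
      using assms x y
      by (simp add: hnorm_add_sq hnorm_smult hinner_simps del: of_real_minus)
         (simp add: power2_eq_square algebra_simps)
    finally have "0 \<le> ?a * ?b * (?a * ?b - ?r)" by simp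
    thus ?thesis using mult_pos_pos[OF x y] by (metis diff_ge_0_iff_ge zero_le_mult_iff not_le order_less_le)
  qed
qed

lemma hnorm_triangle:
  assumes "x \<in> carrier H" "y \<in> carrier H"
  shows "hnorm H (x \<oplus> y) \<le> hnorm H x + hnorm H y"
proof (rule power2_le_imp_le)
  show "(hnorm H (x \<oplus> y))\<^sup>2 \<le> (hnorm H x + hnorm H y)\<^sup>2"
    using assms Cauchy_Schwarz_Re[OF assms] by (simp add: hnorm_add_sq power2_sum)
qed (use assms hnorm_nonneg in simp)

text \<open>
  The metric of the carrier. The locale \<open>Metric_space\<close> demands symmetry and
  nonnegativity on the whole type, where the norm is unspecified outside the carrier; hence the
  value \<open>0\<close> there.
\<close>

definition hdist :: "'a \<Rightarrow> 'a \<Rightarrow> real" where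
  "hdist x y = (if x \<in> carrier H \<and> y \<in> carrier H then hnorm H (x \<ominus> y) else 0)"

lemma diff_add_diff:
  assumes "x \<in> carrier H" "y \<in> carrier H" "z \<in> carrier H"
  shows "(x \<ominus> y) \<oplus> (y \<ominus> z) = x \<ominus> z"
  using assms by (simp add: M.minus_eq M.a_ac M.r_neg2)

lemma diff_eq_zero_iff:
  assumes "x \<in> carrier H" "y \<in> carrier H"
  shows "x \<ominus> y = \<zero> \<longleftrightarrow> x = y"
  using assms M.minus_equality[of x "\<ominus> y"] by (auto simp: M.minus_eq M.r_neg)

lemma Metric_space_hdist: "Metric_space (carrier H) hdist"
proof
  show "0 \<le> hdist x y" for x y by (simp add: hdist_def hnorm_nonneg)
  have "hnorm H (x \<ominus> y) = hnorm H (y \<ominus> x)" if "x \<in> carrier H" "y \<in> carrier H" for x y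
    using hnorm_minus[of "x \<ominus> y"] that by (simp add: M.minus_eq M.minus_add M.a_comm)
  thus "hdist x y = hdist y x" for x y by (simp add: hdist_def)
  show "hdist x y = 0 \<longleftrightarrow> x = y" if "x \<in> carrier H" "y \<in> carrier H" for x y
    using that by (simp add: hdist_def hnorm_eq_0_iff diff_eq_zero_iff)
  show "hdist x z \<le> hdist x y + hdist y z"
    if "x \<in> carrier H" "y \<in> carrier H" "z \<in> carrier H" for x y z
    using that hnorm_triangle[of "x \<ominus> y" "y \<ominus> z"] by (simp add: hdist_def diff_add_diff)
qed

lemma mcomplete_hdist: "Metric_space.mcomplete (carrier H) hdist"
proof -
  interpret D: Metric_space "carrier H" hdist by (rule Metric_space_hdist)
  show ?thesis
    unfolding D.mcomplete_def
  proof (intro allI impI)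
    fix s assume s: "D.MCauchy s"
    hence c: "s n \<in> carrier H" for n by (auto simp: D.MCauchy_def)
    have "\<exists>x\<in>carrier H. (\<lambda>n. hnorm H (s n \<ominus> x)) \<longlonglongrightarrow> 0"
    proof (rule complete[OF c])
      fix e :: real assume "e > 0"
      thus "\<exists>N. \<forall>m\<ge>N. \<forall>n\<ge>N. hnorm H (s m \<ominus> s n) < e"
        using s c unfolding D.MCauchy_def hdist_def by auto
    qed
    thus "\<exists>x. limitin D.mtopology s x sequentially"
      using c by (auto simp: D.limitin_metric_dist_null hdist_def)
  qed
qed

end


section \<open>Operators and invertibility of coercive operators\<close>

context complex_hilbert_space
begin

abbreviation \<B> where "\<B> \<equiv> bounded_ops H"

lemma bounded_ops_apply [simp]:
  "x \<in> carrier H \<Longrightarrow> (S \<oplus>\<^bsub>\<B>\<^esub> T) x = S x \<oplus> T x"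
  "x \<in> carrier H \<Longrightarrow> (c \<odot>\<^bsub>\<B>\<^esub> T) x = c \<odot> T x"
  "x \<in> carrier H \<Longrightarrow> (S \<otimes>\<^bsub>\<B>\<^esub> T) x = S (T x)"
  "x \<in> carrier H \<Longrightarrow> \<one>\<^bsub>\<B>\<^esub> x = x"
  "x \<in> carrier H \<Longrightarrow> \<zero>\<^bsub>\<B>\<^esub> x = \<zero>"
  by (simp_all add: bounded_ops_def compose_def)

lemma carrier_bounded_ops: "T \<in> carrier \<B> \<longleftrightarrow> bounded_op H T"
  by (simp add: bounded_ops_def)

lemma op_closed [simp]: "T \<in> carrier \<B> \<Longrightarrow> x \<in> carrier H \<Longrightarrow> T x \<in> carrier H"
  by (auto simp: carrier_bounded_ops bounded_op_def)

lemma smult_closed_complex [simp]: "x \<in> carrier H \<Longrightarrow> c \<odot> x \<in> carrier H"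
  by simp

lemma smult_laws:
  assumes "x \<in> carrier H"
  shows "(a + b) \<odot> x = a \<odot> x \<oplus> b \<odot> x" "(a * b) \<odot> x = a \<odot> (b \<odot> x)"
    "1 \<odot> x = x" "0 \<odot> x = \<zero>"
  using assms smult_l_distr[of a b x] smult_assoc1[of a b x] smult_one[of x] smult_l_null[of x]
  by simp_all

lemma smult_left_cancel:
  assumes "c \<noteq> 0" "x \<in> carrier H" "y \<in> carrier H"
  shows "c \<odot> x = c \<odot> y \<longleftrightarrow> x = y"
  using assms by (metis left_inverse smult_laws(2,3))

lemma add_diff_add_cancel:
  assumes "x \<in> carrier H" "y \<in> carrier H" "z \<in> carrier H"
  shows "(x \<oplus> z) \<ominus> (y \<oplus> z) = x \<ominus> y"
  using assms by (simp add: M.minus_eq M.minus_add M.a_assoc M.a_comm[of "\<ominus> y"] M.r_neg2)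

lemma op_add:
  "T \<in> carrier \<B> \<Longrightarrow> x \<in> carrier H \<Longrightarrow> y \<in> carrier H \<Longrightarrow> T (x \<oplus> y) = T x \<oplus> T y"
  by (auto simp: carrier_bounded_ops bounded_op_def)

lemma op_smult:
  "T \<in> carrier \<B> \<Longrightarrow> x \<in> carrier H \<Longrightarrow> T (c \<odot> x) = c \<odot> T x"
  by (auto simp: carrier_bounded_ops bounded_op_def)

lemma minus_eq_smult: "x \<in> carrier H \<Longrightarrow> \<ominus> x = (-1) \<odot> x"
  using smult_l_distr[of "-1" 1 x] smult_one[of x] smult_l_null[of x]
  by (intro M.minus_equality) auto

lemma op_minus: "T \<in> carrier \<B> \<Longrightarrow> x \<in> carrier H \<Longrightarrow> T (\<ominus> x) = \<ominus> T x"
  by (simp add: minus_eq_smult op_smult)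

lemma op_diff:
  "T \<in> carrier \<B> \<Longrightarrow> x \<in> carrier H \<Longrightarrow> y \<in> carrier H \<Longrightarrow> T (x \<ominus> y) = T x \<ominus> T y"
  by (simp add: M.minus_eq op_add op_minus)

lemma op_bound:
  assumes "T \<in> carrier \<B>"
  obtains K where "K > 0" "\<And>x. x \<in> carrier H \<Longrightarrow> hnorm H (T x) \<le> K * hnorm H x"
proof -
  obtain K where K: "\<forall>x\<in>carrier H. hnorm H (T x) \<le> K * hnorm H x"
    using assms by (auto simp: carrier_bounded_ops bounded_op_def)
  have "hnorm H (T x) \<le> (\<bar>K\<bar> + 1) * hnorm H x" if "x \<in> carrier H" for x
    using K that mult_right_mono[of K "\<bar>K\<bar> + 1" "hnorm H x"] hnorm_nonneg by fastforce
  thus ?thesis by (intro that[of "\<bar>K\<bar> + 1"]) auto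
qed

lemma op_eqI:
  assumes "S \<in> carrier \<B>" "T \<in> carrier \<B>" "\<And>x. x \<in> carrier H \<Longrightarrow> S x = T x"
  shows "S = T"
  using assms by (intro PiE_ext[of S "carrier H" "\<lambda>_. carrier H" T])
    (auto simp: carrier_bounded_ops bounded_op_def)

lemma bounded_opI:
  assumes "\<And>x. x \<in> carrier H \<Longrightarrow> T x \<in> carrier H"
    and "\<And>x y. x \<in> carrier H \<Longrightarrow> y \<in> carrier H \<Longrightarrow> T (x \<oplus> y) = T x \<oplus> T y"
    and "\<And>c x. x \<in> carrier H \<Longrightarrow> T (c \<odot> x) = c \<odot> T x"
    and "\<And>x. x \<in> carrier H \<Longrightarrow> hnorm H (T x) \<le> K * hnorm H x"
  shows "restrict T (carrier H) \<in> carrier \<B>"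
  using assms by (auto simp: carrier_bounded_ops bounded_op_def intro!: exI[of _ K])

lemma one_op_closed: "\<one>\<^bsub>\<B>\<^esub> \<in> carrier \<B>"
  using bounded_opI[of "\<lambda>x. x" 1] by (simp add: bounded_ops_def)

lemma zero_op_closed: "\<zero>\<^bsub>\<B>\<^esub> \<in> carrier \<B>"
  using bounded_opI[of "\<lambda>x. \<zero>" 0] hnorm_eq_0_iff[of \<zero>] by (simp add: bounded_ops_def)

lemma mult_op_closed:
  assumes "S \<in> carrier \<B>" "T \<in> carrier \<B>"
  shows "S \<otimes>\<^bsub>\<B>\<^esub> T \<in> carrier \<B>"
proof -
  obtain K where K: "K > 0" "\<And>x. x \<in> carrier H \<Longrightarrow> hnorm H (S x) \<le> K * hnorm H x"
    using op_bound[OF assms(1)] by blast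
  obtain L where L: "L > 0" "\<And>x. x \<in> carrier H \<Longrightarrow> hnorm H (T x) \<le> L * hnorm H x"
    using op_bound[OF assms(2)] by blast
  have "restrict (\<lambda>x. S (T x)) (carrier H) \<in> carrier \<B>"
  proof (rule bounded_opI)
    fix x assume x: "x \<in> carrier H"
    have "hnorm H (S (T x)) \<le> K * hnorm H (T x)" using K x assms by simp
    also have "\<dots> \<le> K * (L * hnorm H x)" using K L x by (intro mult_left_mono) auto
    finally show "hnorm H (S (T x)) \<le> (K * L) * hnorm H x" by (simp add: mult.assoc)
  qed (use assms in \<open>simp_all add: op_add op_smult\<close>)
  thus ?thesis by (simp add: bounded_ops_def compose_def)
qed

lemma add_op_closed:
  assumes "S \<in> carrier \<B>" "T \<in> carrier \<B>"
  shows "S \<oplus>\<^bsub>\<B>\<^esub> T \<in> carrier \<B>"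
proof -
  obtain K where K: "K > 0" "\<And>x. x \<in> carrier H \<Longrightarrow> hnorm H (S x) \<le> K * hnorm H x"
    using op_bound[OF assms(1)] by blast
  obtain L where L: "L > 0" "\<And>x. x \<in> carrier H \<Longrightarrow> hnorm H (T x) \<le> L * hnorm H x"
    using op_bound[OF assms(2)] by blast
  have "restrict (\<lambda>x. S x \<oplus> T x) (carrier H) \<in> carrier \<B>"
  proof (rule bounded_opI)
    fix x assume x: "x \<in> carrier H"
    have "hnorm H (S x \<oplus> T x) \<le> hnorm H (S x) + hnorm H (T x)"
      using x assms by (simp add: hnorm_triangle)
    thus "hnorm H (S x \<oplus> T x) \<le> (K + L) * hnorm H x"
      using K(2)[OF x] L(2)[OF x] by (simp add: distrib_right)
  qed (use assms in \<open>simp_all add: op_add op_smult M.a_ac smult_r_distr\<close>)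
  thus ?thesis by (simp add: bounded_ops_def)
qed

lemma smult_op_closed:
  assumes "T \<in> carrier \<B>"
  shows "c \<odot>\<^bsub>\<B>\<^esub> T \<in> carrier \<B>"
proof -
  obtain K where K: "K > 0" "\<And>x. x \<in> carrier H \<Longrightarrow> hnorm H (T x) \<le> K * hnorm H x"
    using op_bound[OF assms] by blast
  have "restrict (\<lambda>x. c \<odot> T x) (carrier H) \<in> carrier \<B>"
  proof (rule bounded_opI)
    fix x assume x: "x \<in> carrier H"
    show "hnorm H (c \<odot> T x) \<le> (cmod c * K) * hnorm H x"
      using K(2)[OF x] x assms by (simp add: hnorm_smult mult.assoc mult_left_mono)
    show "c \<odot> T (b \<odot> x) = b \<odot> (c \<odot> T x)" for b
      using smult_assoc1[of c b "T x"] smult_assoc1[of b c "T x"] x assms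
      by (simp add: op_smult mult.commute)
  qed (use assms in \<open>simp_all add: op_add smult_r_distr\<close>)
  thus ?thesis by (simp add: bounded_ops_def)
qed

lemmas op_closures = one_op_closed zero_op_closed mult_op_closed add_op_closed smult_op_closed

lemma monoid_bounded_ops: "Group.monoid \<B>"
  by (intro monoidI op_closures op_eqI) (simp_all add: op_closures)

lemma abelian_group_bounded_ops: "abelian_group \<B>"
proof (intro abelian_groupI)
  fix T assume T: "T \<in> carrier \<B>"
  have "(-1) \<odot>\<^bsub>\<B>\<^esub> T \<oplus>\<^bsub>\<B>\<^esub> T = \<zero>\<^bsub>\<B>\<^esub>"
    by (intro op_eqI op_closures T)
      (simp add: op_closures T M.l_neg flip: minus_eq_smult)
  thus "\<exists>S\<in>carrier \<B>. S \<oplus>\<^bsub>\<B>\<^esub> T = \<zero>\<^bsub>\<B>\<^esub>"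
    using T by (intro bexI[of _ "(-1) \<odot>\<^bsub>\<B>\<^esub> T"] op_closures)
qed (auto intro!: op_closures op_eqI simp: op_closures M.a_ac)

sublocale Ops: abelian_group \<B> by (rule abelian_group_bounded_ops)

sublocale OpMonoid: Group.monoid \<B> by (rule monoid_bounded_ops)

lemma minus_op_apply [simp]:
  assumes "T \<in> carrier \<B>" "x \<in> carrier H"
  shows "(\<ominus>\<^bsub>\<B>\<^esub> T) x = \<ominus> T x"
proof -
  have "(\<ominus>\<^bsub>\<B>\<^esub> T \<oplus>\<^bsub>\<B>\<^esub> T) x = \<zero>" using assms by (simp only: Ops.l_neg bounded_ops_apply)
  thus ?thesis using assms M.minus_equality[of "(\<ominus>\<^bsub>\<B>\<^esub> T) x" "T x"] by simp
qed

lemma diff_op_apply [simp]: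
  assumes "T \<in> carrier \<B>" "x \<in> carrier H"
  shows "(S \<ominus>\<^bsub>\<B>\<^esub> T) x = S x \<ominus> T x"
  using assms by (simp add: a_minus_def)

lemma scalar_minus_closed: "T \<in> carrier \<B> \<Longrightarrow> scalar_minus H z T \<in> carrier \<B>"
  by (simp add: scalar_minus_def op_closures)

lemma scalar_minus_apply:
  "T \<in> carrier \<B> \<Longrightarrow> x \<in> carrier H \<Longrightarrow> scalar_minus H z T x = z \<odot> x \<ominus> T x"
  by (simp add: scalar_minus_def op_closures)

text \<open>
  The Lax--Milgram lemma, by Zarantonello's argument: the equation \<open>T x = y\<close> is the
  fixed point equation of \<open>x \<mapsto> x - a (T x - y)\<close>, and for a small multiple
  \<open>a\<close> of \<open>w\<close> coercivity turns this map into a contraction. The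
  unimodular direction of \<open>w\<close> rotates the numerical range of \<open>T\<close> into
  the right half-plane, which is what non-real points of the resolvent set need.
\<close>

lemma coercive_imp_unit:
  assumes T: "T \<in> carrier \<B>" and w: "w \<noteq> 0" and c: "c > 0"
    and coercive: "\<And>x. x \<in> carrier H \<Longrightarrow> c * (hnorm H x)\<^sup>2 \<le> Re (w * hinner H (T x) x)"
  shows "T \<in> Units \<B>"
proof -
  interpret D: Metric_space "carrier H" hdist by (rule Metric_space_hdist)
  obtain K where K: "K > 0" "\<And>x. x \<in> carrier H \<Longrightarrow> hnorm H (T x) \<le> K * hnorm H x"
    using op_bound[OF T] by blast
  \<comment> \<open>With \<open>a = (c / L) w\<close> the square of the contraction constant is at most
    \<open>1 - 2 c\<^sup>2 / L + c\<^sup>2 (cmod w K)\<^sup>2 / L\<^sup>2\<close>, so \<open>L \<ge> (cmod w K)\<^sup>2\<close> bounds it by \<open>1 - c\<^sup>2 / L\<close>; the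
    summand \<open>c\<^sup>2 + 1\<close> keeps this bound positive.\<close>
  define L where "L = (cmod w * K)\<^sup>2 + c\<^sup>2 + 1"
  have L: "L > 0" "(cmod w * K)\<^sup>2 \<le> L" "c\<^sup>2 < L" unfolding L_def
    by (auto intro: add_nonneg_pos add_pos_nonneg simp: add_strict_increasing2)
  define a where "a = complex_of_real (c / L) * w"
  have step: "(hnorm H (x \<ominus> a \<odot> T x))\<^sup>2 \<le> (1 - c\<^sup>2 / L) * (hnorm H x)\<^sup>2"
    if x: "x \<in> carrier H" for x
  proof -
    let ?n = "hnorm H x"
    have r: "Re (hinner H x (\<ominus> (a \<odot> T x))) = - (c / L * Re (w * hinner H (T x) x))"
      using x T hinner_commute[of x "T x"]
      by (simp add: hinner_simps a_def algebra_simps diff_divide_distrib)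
    have "(hnorm H (x \<ominus> a \<odot> T x))\<^sup>2 =
        ?n\<^sup>2 - 2 * (c / L) * Re (w * hinner H (T x) x) + (c / L)\<^sup>2 * (cmod w * hnorm H (T x))\<^sup>2"
      using x T by (simp add: M.minus_eq hnorm_add_sq r hnorm_minus hnorm_smult)
        (simp add: a_def norm_mult norm_divide power_mult_distrib power_divide)
    also have "\<dots> \<le> ?n\<^sup>2 - 2 * (c / L) * (c * ?n\<^sup>2) + (c / L)\<^sup>2 * (L * ?n\<^sup>2)"
    proof -
      have 1: "(c / L) * (c * ?n\<^sup>2) \<le> (c / L) * Re (w * hinner H (T x) x)"
        using coercive[OF x] c L by (intro mult_left_mono) auto
      have "(cmod w * hnorm H (T x))\<^sup>2 \<le> (cmod w * (K * ?n))\<^sup>2"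
        using K x T hnorm_nonneg by (intro power_mono mult_left_mono) auto
      also have "\<dots> = (cmod w * K)\<^sup>2 * ?n\<^sup>2" by (simp add: power_mult_distrib)
      also have "\<dots> \<le> L * ?n\<^sup>2" using L by (intro mult_right_mono) auto
      finally have 2: "(c / L)\<^sup>2 * (cmod w * hnorm H (T x))\<^sup>2 \<le> (c / L)\<^sup>2 * (L * ?n\<^sup>2)"
        by (intro mult_left_mono) auto
      show ?thesis using 1 2 by linarith
    qed
    also have "\<dots> = (1 - c\<^sup>2 / L) * ?n\<^sup>2"
      using L(1) by (simp add: field_simps power2_eq_square)
    finally show ?thesis .
  qed
  define k where "k = sqrt (1 - c\<^sup>2 / L)"
  have k: "k < 1" "0 \<le> k" using L c by (auto simp: k_def)
  have k2: "k\<^sup>2 = 1 - c\<^sup>2 / L" using L by (simp add: k_def)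
  have contr: "hnorm H (x \<ominus> a \<odot> T x) \<le> k * hnorm H x" if "x \<in> carrier H" for x
  proof (rule power2_le_imp_le)
    show "(hnorm H (x \<ominus> a \<odot> T x))\<^sup>2 \<le> (k * hnorm H x)\<^sup>2"
      using step[OF that] by (simp only: power_mult_distrib k2)
  qed (use k hnorm_nonneg[OF that] in simp)
  define S where "S = a \<odot>\<^bsub>\<B>\<^esub> T"
  have S: "S \<in> carrier \<B>" "\<And>x. x \<in> carrier H \<Longrightarrow> S x = a \<odot> T x"
    using T by (simp_all add: S_def op_closures)
  define R where "R = \<one>\<^bsub>\<B>\<^esub> \<ominus>\<^bsub>\<B>\<^esub> S"
  have R: "R \<in> carrier \<B>" "\<And>x. x \<in> carrier H \<Longrightarrow> R x = x \<ominus> S x"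
    using S by (simp_all add: R_def op_closures)
  have a: "a \<noteq> 0" using w c L by (simp add: a_def)
  have ex1: "\<exists>!x. x \<in> carrier H \<and> T x = y" if y: "y \<in> carrier H" for y
  proof -
    let ?f = "\<lambda>x. R x \<oplus> a \<odot> y"
    obtain x where x: "x \<in> carrier H" "?f x = x"
    proof (rule D.Banach_fixedpoint_thm[OF mcomplete_hdist])
      show "carrier H \<noteq> {}" "?f \<in> carrier H \<rightarrow> carrier H" using y R(1) by auto
      fix x x' assume x: "x \<in> carrier H" "x' \<in> carrier H"
      have "?f x \<ominus> ?f x' = R (x \<ominus> x')"
        using x y R(1) by (simp add: op_diff add_diff_add_cancel)
      moreover have "?f x \<in> carrier H" "?f x' \<in> carrier H" using x y R(1) by simp_all
      moreover have "hnorm H (R (x \<ominus> x')) \<le> k * hnorm H (x \<ominus> x')"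
        using contr[of "x \<ominus> x'"] x by (simp add: R(2) S(2))
      ultimately show "hdist (?f x) (?f x') \<le> k * hdist x x'"
        using x by (simp only: hdist_def) simp
    qed (use k in auto)
    have "?f x \<ominus> x = a \<odot> y \<ominus> a \<odot> T x"
      using x(1) y T by (simp add: R(2) S(2) M.minus_eq M.a_ac M.r_neg2 M.r_neg1)
    hence "a \<odot> y \<ominus> a \<odot> T x = \<zero>" using x diff_eq_zero_iff[of x x] by simp
    hence "T x = y" using a x(1) y T smult_left_cancel[of a y "T x"] by (simp add: diff_eq_zero_iff)
    moreover have "x' = x''"
      if x': "x' \<in> carrier H" "x'' \<in> carrier H" "T x' = T x''" for x' x''
    proof -
      have "T (x' \<ominus> x'') = \<zero>" using x' T by (simp add: op_diff diff_eq_zero_iff)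
      hence "c * (hnorm H (x' \<ominus> x''))\<^sup>2 \<le> 0"
        using coercive[of "x' \<ominus> x''"] x' by (simp add: hinner_zero_left)
      hence "hnorm H (x' \<ominus> x'') = 0" using c by (simp add: mult_le_0_iff)
      thus ?thesis using x' by (simp add: hnorm_eq_0_iff diff_eq_zero_iff)
    qed
    ultimately show ?thesis using x(1) by metis
  qed
  define g where "g = (\<lambda>y. THE x. x \<in> carrier H \<and> T x = y)"
  have g: "g y \<in> carrier H" "T (g y) = y" if "y \<in> carrier H" for y
    using theI'[OF ex1[OF that]] by (auto simp: g_def)
  have gI: "g y = x" if "x \<in> carrier H" "T x = y" for x y
    using ex1[of y] that g[of y] op_closed[OF T, of x] by metis
  have "restrict g (carrier H) \<in> carrier \<B>"
  proof (rule bounded_opI)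
    fix y assume y: "y \<in> carrier H"
    have "c * (hnorm H (g y))\<^sup>2 \<le> Re (hinner H (w \<odot> y) (g y))"
      using coercive[of "g y"] g[OF y] y by (simp add: hinner_simps)
    also have "\<dots> \<le> cmod w * hnorm H y * hnorm H (g y)"
      using Cauchy_Schwarz_Re[of "w \<odot> y" "g y"] g[OF y] y by (simp add: hnorm_smult)
    finally have "hnorm H (g y) * (c * hnorm H (g y)) \<le> hnorm H (g y) * (cmod w * hnorm H y)"
      by (simp add: power2_eq_square ac_simps)
    hence "c * hnorm H (g y) \<le> cmod w * hnorm H y"
      using hnorm_nonneg[of "g y"] g[OF y] hnorm_nonneg[OF y]
      by (cases "hnorm H (g y) = 0") (auto simp: mult_le_cancel_left)
    thus "hnorm H (g y) \<le> (cmod w / c) * hnorm H y"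
      using c by (simp add: field_simps)
  qed (use g T in \<open>auto intro!: gI simp: op_add op_smult\<close>)
  moreover have "restrict g (carrier H) \<otimes>\<^bsub>\<B>\<^esub> T = \<one>\<^bsub>\<B>\<^esub>"
    "T \<otimes>\<^bsub>\<B>\<^esub> restrict g (carrier H) = \<one>\<^bsub>\<B>\<^esub>"
    using calculation T g by (auto intro!: op_eqI op_closures gI)
  ultimately show ?thesis using T by (auto simp: Units_def)
qed

end


section \<open>Strictly negative operators\<close>

context complex_hilbert_space
begin

abbreviation scalar_op :: "complex \<Rightarrow> 'a \<Rightarrow> 'a" where
  "scalar_op c \<equiv> c \<odot>\<^bsub>\<B>\<^esub> \<one>\<^bsub>\<B>\<^esub>"

lemma positive_op_iff:
  "positive_op H T \<longleftrightarrow> T \<in> carrier \<B> \<and> (\<forall>x\<in>carrier H. hinner H (T x) x \<in> \<real>\<^sub>\<ge>\<^sub>0)"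
  by (simp add: positive_op_def carrier_bounded_ops)

lemma op_le_iff:
  assumes "S \<in> carrier \<B>" "T \<in> carrier \<B>"
  shows "op_le H S T \<longleftrightarrow> (\<forall>x\<in>carrier H. hinner H (T x) x - hinner H (S x) x \<in> \<real>\<^sub>\<ge>\<^sub>0)"
  using assms by (simp add: op_le_def positive_op_iff hinner_simps op_closed)

text \<open>
  Polarization: reality of the form at \<open>x + y\<close> and at \<open>x + \<i> y\<close> gives
  the imaginary and the real part of the symmetry relation.
\<close>

lemma real_form_imp_self_adjoint:
  assumes T: "T \<in> carrier \<B>"
    and real: "\<And>x. x \<in> carrier H \<Longrightarrow> Im (hinner H (T x) x) = 0"
  shows "self_adjoint H T"
  unfolding self_adjoint_def is_adjoint_def
proof (intro conjI ballI)
  show "bounded_op H T" using T by (simp add: carrier_bounded_ops)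
  fix x y assume xy: "x \<in> carrier H" "y \<in> carrier H"
  have "Im (hinner H (T x) y) = - Im (hinner H (T y) x)"
    using real[of "x \<oplus> y"] real[of x] real[of y] xy T by (simp add: op_add hinner_simps)
  moreover have "Re (hinner H (T x) y) = Re (hinner H (T y) x)"
    using real[of "x \<oplus> \<i> \<odot> y"] real[of x] real[of y] xy T
    by (simp add: op_add op_smult hinner_simps)
  ultimately have "hinner H (T x) y = cnj (hinner H (T y) x)"
    by (simp add: complex_eq_iff)
  thus "hinner H (T x) y = hinner H x (T y)"
    using hinner_commute[of x "T y"] xy T by simp
qed

lemma self_adjointD:
  "self_adjoint H T \<Longrightarrow> x \<in> carrier H \<Longrightarrow> y \<in> carrier H \<Longrightarrow> hinner H (T x) y = hinner H x (T y)"
  by (simp add: self_adjoint_def is_adjoint_def)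

text \<open>
  Negative operators bounded away from zero. Unlike negative invertible operators, they are
  visibly closed under sums, and shifts by scalars off the negative half-line are visibly
  coercive.
\<close>

definition strictly_negative :: "('a \<Rightarrow> 'a) \<Rightarrow> bool" where
  "strictly_negative T \<longleftrightarrow> T \<in> carrier \<B> \<and>
     (\<exists>d>0. \<forall>x\<in>carrier H. Im (hinner H (T x) x) = 0 \<and>
        Re (hinner H (T x) x) \<le> - d * (hnorm H x)\<^sup>2)"

lemma strictly_negativeE:
  assumes "strictly_negative T"
  obtains d where "T \<in> carrier \<B>" "d > 0"
    "\<And>x. x \<in> carrier H \<Longrightarrow> Im (hinner H (T x) x) = 0"
    "\<And>x. x \<in> carrier H \<Longrightarrow> Re (hinner H (T x) x) \<le> - d * (hnorm H x)\<^sup>2"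
  using assms unfolding strictly_negative_def by blast

lemma strictly_negative_imp_closed: "strictly_negative T \<Longrightarrow> T \<in> carrier \<B>"
  by (simp add: strictly_negative_def)

lemma strictly_negative_imp_self_adjoint: "strictly_negative T \<Longrightarrow> self_adjoint H T"
  by (elim strictly_negativeE) (rule real_form_imp_self_adjoint)

lemma negative_opD:
  assumes "negative_op H T" "x \<in> carrier H"
  shows "T \<in> carrier \<B>" "Im (hinner H (T x) x) = 0" "Re (hinner H (T x) x) \<le> 0"
proof -
  show T: "T \<in> carrier \<B>" using assms by (simp add: negative_op_def carrier_bounded_ops)
  have "- hinner H (T x) x \<in> \<real>\<^sub>\<ge>\<^sub>0"
    using assms T by (auto simp: negative_op_def positive_op_iff hinner_simps)
  thus "Im (hinner H (T x) x) = 0" "Re (hinner H (T x) x) \<le> 0"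
    by (auto simp: complex_nonneg_Reals_iff)
qed

text \<open>
  Put \<open>y = A x\<close>. Negativity of the form at \<open>x + s y\<close> reads
  \<open>\<langle>A x, x\<rangle> + 2 s \<parallel>y\<parallel>\<^sup>2 + s\<^sup>2 \<langle>A y,
  y\<rangle> \<le> 0\<close>, where \<open>- \<langle>A y, y\<rangle> \<le> K
  \<parallel>y\<parallel>\<^sup>2\<close>. The choice \<open>s = 1 / K\<close> leaves
  \<open>\<langle>A x, x\<rangle> \<le> - \<parallel>A x\<parallel>\<^sup>2 / K\<close>, and
  \<open>\<parallel>A x\<parallel>\<close> is bounded below by means of the inverse.
\<close>

lemma negative_unit_imp_strictly_negative:
  assumes neg: "negative_op H A" and unit: "A \<in> Units \<B>"
  shows "strictly_negative A"
proof -
  have A: "A \<in> carrier \<B>" using unit by (rule OpMonoid.Units_closed)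
  have sa: "self_adjoint H A"
    using A negative_opD[OF neg] by (intro real_form_imp_self_adjoint)
  obtain K where K: "K > 0" "\<And>x. x \<in> carrier H \<Longrightarrow> hnorm H (A x) \<le> K * hnorm H x"
    using op_bound[OF A] by blast
  obtain L where L: "L > 0"
      "\<And>x. x \<in> carrier H \<Longrightarrow> hnorm H ((inv\<^bsub>\<B>\<^esub> A) x) \<le> L * hnorm H x"
    using op_bound[OF OpMonoid.Units_inv_closed[OF unit]] by blast
  have "Re (hinner H (A x) x) \<le> - (1 / (K * L\<^sup>2)) * (hnorm H x)\<^sup>2" if x: "x \<in> carrier H" for x
  proof -
    define y where "y = A x"
    have y: "y \<in> carrier H" using A x by (simp add: y_def)
    have "(inv\<^bsub>\<B>\<^esub> A \<otimes>\<^bsub>\<B>\<^esub> A) x = x" using OpMonoid.Units_l_inv[OF unit] x by simp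
    hence "hnorm H x \<le> L * hnorm H y" using L(2)[OF y] x by (simp add: y_def)
    hence "(hnorm H x)\<^sup>2 \<le> (L * hnorm H y)\<^sup>2" using hnorm_nonneg[OF x] by (rule power_mono)
    hence 1: "(hnorm H x)\<^sup>2 / L\<^sup>2 \<le> (hnorm H y)\<^sup>2"
      using L by (simp add: power_mult_distrib field_simps)
    have "- Re (hinner H (A y) y) \<le> hnorm H (A y) * hnorm H y"
      using Cauchy_Schwarz_Re[of "\<ominus> A y" y] A y by (simp add: hinner_simps hnorm_minus)
    also have "\<dots> \<le> K * hnorm H y * hnorm H y"
      using K(2)[OF y] hnorm_nonneg[OF y] by (intro mult_right_mono)
    finally have 2: "- Re (hinner H (A y) y) \<le> K * (hnorm H y)\<^sup>2"
      by (simp add: power2_eq_square)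
    define s where "s = 1 / K"
    let ?z = "x \<oplus> complex_of_real s \<odot> y"
    have xy: "hinner H (A x) y = (hnorm H y)\<^sup>2" "hinner H (A y) x = (hnorm H y)\<^sup>2"
      using hinner_self[OF y] self_adjointD[OF sa y x] by (simp_all add: y_def)
    have "Re (hinner H (A ?z) ?z) \<le> 0" using x y by (intro negative_opD[OF neg]) auto
    hence "Re (hinner H (A x) x) + 2 * s * (hnorm H y)\<^sup>2 + s\<^sup>2 * Re (hinner H (A y) y) \<le> 0"
      using x y A xy by (simp add: op_add op_smult hinner_simps power2_eq_square algebra_simps)
    moreover have "- (s\<^sup>2 * Re (hinner H (A y) y)) \<le> s * (hnorm H y)\<^sup>2"
      using mult_left_mono[OF 2, of "s\<^sup>2"] K(1) by (simp add: s_def power2_eq_square)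
    ultimately have "Re (hinner H (A x) x) \<le> - s * (hnorm H y)\<^sup>2" by linarith
    also have "\<dots> \<le> - s * ((hnorm H x)\<^sup>2 / L\<^sup>2)"
      using mult_left_mono[OF 1, of s] K by (simp add: s_def)
    finally show ?thesis by (simp add: s_def)
  qed
  moreover have "1 / (K * L\<^sup>2) > 0" using K L by simp
  ultimately show ?thesis
    unfolding strictly_negative_def using A negative_opD(2)[OF neg] by blast
qed

lemma strictly_negative_add:
  assumes "strictly_negative S" "strictly_negative T"
  shows "strictly_negative (S \<oplus>\<^bsub>\<B>\<^esub> T)"
proof -
  obtain d where d: "S \<in> carrier \<B>" "d > 0"
    "\<And>x. x \<in> carrier H \<Longrightarrow> Im (hinner H (S x) x) = 0"
    "\<And>x. x \<in> carrier H \<Longrightarrow> Re (hinner H (S x) x) \<le> - d * (hnorm H x)\<^sup>2"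
    using strictly_negativeE[OF assms(1)] by blast
  obtain e where e: "T \<in> carrier \<B>" "e > 0"
    "\<And>x. x \<in> carrier H \<Longrightarrow> Im (hinner H (T x) x) = 0"
    "\<And>x. x \<in> carrier H \<Longrightarrow> Re (hinner H (T x) x) \<le> - e * (hnorm H x)\<^sup>2"
    using strictly_negativeE[OF assms(2)] by blast
  have "Im (hinner H ((S \<oplus>\<^bsub>\<B>\<^esub> T) x) x) = 0 \<and>
      Re (hinner H ((S \<oplus>\<^bsub>\<B>\<^esub> T) x) x) \<le> - (d + e) * (hnorm H x)\<^sup>2" if "x \<in> carrier H" for x
    using d(3,4)[OF that] e(3,4)[OF that] d(1) e(1) that
    by (simp add: hinner_simps algebra_simps)
  moreover have "d + e > 0" using d(2) e(2) by simp
  ultimately show ?thesis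
    unfolding strictly_negative_def using add_op_closed[OF d(1) e(1)] by blast
qed

lemma strictly_negative_scalar_op:
  assumes "t < 0"
  shows "strictly_negative (scalar_op (complex_of_real t))"
  unfolding strictly_negative_def
  using assms by (auto intro!: op_closures exI[of _ "- t"] simp: hinner_simps hinner_self
    simp flip: of_real_mult)

lemma hinner_scalar_minus:
  assumes "T \<in> carrier \<B>" "x \<in> carrier H"
  shows "hinner H (scalar_minus H z T x) x = z * complex_of_real ((hnorm H x)\<^sup>2) - hinner H (T x) x"
  using assms by (simp add: scalar_minus_apply hinner_simps hinner_self del: of_real_power)

text \<open>
  For real \<open>z \<ge> 0\<close> the form of \<open>z - T\<close> is bounded below by
  \<open>d\<close>. For non-real \<open>z\<close> its imaginary part is \<open>Im z
  \<parallel>x\<parallel>\<^sup>2\<close>, since the form of \<open>T\<close> is real;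
  multiplication by \<open>- \<i> Im z\<close> makes this a positive real part.
\<close>

lemma strictly_negative_resolvent:
  assumes T: "strictly_negative T" and z: "z \<notin> complex_of_real ` {..<0}"
  shows "scalar_minus H z T \<in> Units \<B>"
proof -
  obtain d where d: "T \<in> carrier \<B>" "d > 0"
    "\<And>x. x \<in> carrier H \<Longrightarrow> Im (hinner H (T x) x) = 0"
    "\<And>x. x \<in> carrier H \<Longrightarrow> Re (hinner H (T x) x) \<le> - d * (hnorm H x)\<^sup>2"
    using strictly_negativeE[OF T] by blast
  note c = scalar_minus_closed[OF d(1)]
  show ?thesis
  proof (cases "Im z = 0")
    case True
    have "z = complex_of_real (Re z)" using True by (simp add: complex_eq_iff)
    hence "0 \<le> Re z" using z by (metis imageI lessThan_iff not_le)
    show ?thesis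
    proof (rule coercive_imp_unit[OF c, of 1 d])
      fix x assume x: "x \<in> carrier H"
      have "0 \<le> Re z * (hnorm H x)\<^sup>2" using \<open>0 \<le> Re z\<close> by simp
      thus "d * (hnorm H x)\<^sup>2 \<le> Re (1 * hinner H (scalar_minus H z T x) x)"
        using d(4)[OF x] d(1) x by (simp add: hinner_scalar_minus del: of_real_power)
    qed (use d in auto)
  next
    case False
    show ?thesis
    proof (rule coercive_imp_unit[OF c, of "- \<i> * complex_of_real (Im z)" "(Im z)\<^sup>2"])
      fix x assume x: "x \<in> carrier H"
      show "(Im z)\<^sup>2 * (hnorm H x)\<^sup>2 \<le>
          Re (- \<i> * complex_of_real (Im z) * hinner H (scalar_minus H z T x) x)"
        using d(3)[OF x] d(1) x
        by (simp add: hinner_scalar_minus power2_eq_square del: of_real_power)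
    qed (use False in auto)
  qed
qed

lemma strictly_negative_spectrum:
  "strictly_negative T \<Longrightarrow> spectrum H T \<subseteq> complex_of_real ` {..<0}"
  unfolding spectrum_def using strictly_negative_resolvent by blast

text \<open>
  With \<open>y = (\<lambda> - B)\<^sup>-\<^sup>1 A x\<close> the form of \<open>A (\<lambda> -
  B)\<^sup>-\<^sup>1 A\<close> at \<open>x\<close> is the conjugate of the form of
  \<open>\<lambda> - B\<close> at \<open>y\<close>, which is nonnegative.
\<close>

lemma positive_sandwich_resolvent:
  assumes A: "self_adjoint H A" and B: "strictly_negative B" and l: "0 \<le> l"
  shows "positive_op H
    (A \<otimes>\<^bsub>\<B>\<^esub> inv\<^bsub>\<B>\<^esub> (scalar_minus H (complex_of_real l) B) \<otimes>\<^bsub>\<B>\<^esub> A)"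
proof -
  let ?R = "scalar_minus H (complex_of_real l) B"
  have Ac: "A \<in> carrier \<B>" using A by (simp add: self_adjoint_def carrier_bounded_ops)
  obtain d where d: "B \<in> carrier \<B>" "d > 0"
    "\<And>x. x \<in> carrier H \<Longrightarrow> Im (hinner H (B x) x) = 0"
    "\<And>x. x \<in> carrier H \<Longrightarrow> Re (hinner H (B x) x) \<le> - d * (hnorm H x)\<^sup>2"
    using strictly_negativeE[OF B] by blast
  have unit: "?R \<in> Units \<B>" using l by (intro strictly_negative_resolvent[OF B]) auto
  have inv: "inv\<^bsub>\<B>\<^esub> ?R \<in> carrier \<B>" using unit by (rule OpMonoid.Units_inv_closed)
  have "hinner H (A ((inv\<^bsub>\<B>\<^esub> ?R) (A x))) x \<in> \<real>\<^sub>\<ge>\<^sub>0" if x: "x \<in> carrier H" for x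
  proof -
    define y where "y = (inv\<^bsub>\<B>\<^esub> ?R) (A x)"
    have y: "y \<in> carrier H" using Ac inv x by (simp add: y_def)
    have "(?R \<otimes>\<^bsub>\<B>\<^esub> inv\<^bsub>\<B>\<^esub> ?R) (A x) = A x"
      using OpMonoid.Units_r_inv[OF unit] Ac x by simp
    hence Ry: "?R y = A x" using Ac x by (simp add: y_def)
    have "hinner H (A y) x = hinner H y (?R y)"
      using self_adjointD[OF A y x] by (simp add: Ry)
    also have "\<dots> = cnj (hinner H (?R y) y)"
      using y scalar_minus_closed[OF d(1)] by (intro hinner_commute) auto
    finally have eq: "hinner H (A y) x = cnj (hinner H (?R y) y)" .
    have "- d * (hnorm H y)\<^sup>2 \<le> 0" "0 \<le> l * (hnorm H y)\<^sup>2" using d(2) l by simp_all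
    hence "hinner H (?R y) y \<in> \<real>\<^sub>\<ge>\<^sub>0"
      using d(3,4)[OF y] d(1) y
      by (simp add: hinner_scalar_minus complex_nonneg_Reals_iff del: of_real_power)
    thus ?thesis unfolding y_def[symmetric] eq by (simp add: complex_nonneg_Reals_iff)
  qed
  thus ?thesis using Ac inv by (auto simp: positive_op_iff intro!: op_closures)
qed

lemma ex_scalar_op_le:
  assumes "strictly_negative T"
  obtains t where "t < 0" "op_le H (scalar_op (complex_of_real t)) T"
proof -
  have T: "T \<in> carrier \<B>" "\<And>x. x \<in> carrier H \<Longrightarrow> Im (hinner H (T x) x) = 0"
    using assms by (auto simp: strictly_negative_def)
  obtain K where K: "K > 0" "\<And>x. x \<in> carrier H \<Longrightarrow> hnorm H (T x) \<le> K * hnorm H x"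
    using op_bound[OF T(1)] by blast
  have "- Re (hinner H (T x) x) \<le> K * (hnorm H x)\<^sup>2" if x: "x \<in> carrier H" for x
  proof -
    have "- Re (hinner H (T x) x) \<le> hnorm H (T x) * hnorm H x"
      using Cauchy_Schwarz_Re[of "\<ominus> T x" x] T x by (simp add: hinner_simps hnorm_minus)
    also have "\<dots> \<le> K * hnorm H x * hnorm H x"
      using K(2)[OF x] hnorm_nonneg[OF x] by (intro mult_right_mono)
    finally show ?thesis by (simp add: power2_eq_square)
  qed
  hence "op_le H (scalar_op (complex_of_real (- K))) T"
    using T by (subst op_le_iff) (fastforce intro: op_closures
      simp: hinner_simps hinner_self complex_nonneg_Reals_iff simp del: of_real_power)+
  thus ?thesis using K(1) by (intro that[of "- K"]) auto
qed

end


section \<open>Functional calculus of multiples of the identity\<close>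

context complex_hilbert_space
begin

text \<open>
  Only an inclusion: on the zero space every operator is invertible and the spectrum is empty.
\<close>

lemma spectrum_scalar_op: "spectrum H (scalar_op c) \<subseteq> {c}"
proof
  fix z assume z: "z \<in> spectrum H (scalar_op c)"
  show "z \<in> {c}"
  proof (rule ccontr)
    assume "z \<notin> {c}"
    hence zc: "z - c \<noteq> 0" by simp
    have "scalar_minus H z (scalar_op c) \<in> Units \<B>"
    proof (rule coercive_imp_unit[of _ "cnj (z - c)" "(cmod (z - c))\<^sup>2"])
      fix x assume x: "x \<in> carrier H"
      have "cnj (z - c) * hinner H (scalar_minus H z (scalar_op c) x) x =
          (cnj (z - c) * (z - c)) * complex_of_real ((hnorm H x)\<^sup>2)"
        using x by (simp add: hinner_scalar_minus op_closures hinner_simps hinner_self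
          algebra_simps del: of_real_power complex_cnj_diff)
      also have "cnj (z - c) * (z - c) = complex_of_real ((cmod (z - c))\<^sup>2)"
        by (simp only: complex_norm_square mult.commute)
      finally show "(cmod (z - c))\<^sup>2 * (hnorm H x)\<^sup>2 \<le>
          Re (cnj (z - c) * hinner H (scalar_minus H z (scalar_op c) x) x)"
        by simp
    qed (use zc in \<open>auto intro!: scalar_minus_closed op_closures\<close>)
    thus False using z by (simp add: spectrum_def)
  qed
qed

text \<open>
  If the spectrum is empty, then the zero operator is invertible, hence the space is zero and all
  operators coincide.
\<close>

lemma scalar_op_eq_on_spectrum:
  assumes "\<forall>z\<in>spectrum H (scalar_op c). g z = h z"
  shows "scalar_op (g c) = scalar_op (h c)"
proof (cases "c \<in> spectrum H (scalar_op c)")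
  case True
  thus ?thesis using assms by simp
next
  case False
  let ?Z = "scalar_minus H c (scalar_op c)"
  have unit: "?Z \<in> Units \<B>" using False by (simp add: spectrum_def)
  have inv: "inv\<^bsub>\<B>\<^esub> ?Z \<in> carrier \<B>" using unit by (rule OpMonoid.Units_inv_closed)
  have "x = \<zero>" if x: "x \<in> carrier H" for x
  proof -
    have "?Z x = \<zero>" using x by (simp add: scalar_minus_apply op_closures diff_eq_zero_iff)
    moreover have "(inv\<^bsub>\<B>\<^esub> ?Z \<otimes>\<^bsub>\<B>\<^esub> ?Z) x = x"
      using OpMonoid.Units_l_inv[OF unit] x by simp
    moreover have "(inv\<^bsub>\<B>\<^esub> ?Z) \<zero> = \<zero>"
      using op_smult[OF inv, of \<zero> 0] op_closed[OF inv, of \<zero>] by (simp add: smult_laws)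
    ultimately show ?thesis using x by simp
  qed
  hence "a \<odot> x = b \<odot> x" if "x \<in> carrier H" for a b x
    using that by (metis smult_closed_complex)
  thus ?thesis by (intro op_eqI op_closures) simp
qed

text \<open>
  The map \<open>h \<mapsto> h(c) I\<close> is a functional calculus, and it is the only one,
  because every function agrees on the spectrum with a constant.
\<close>

lemma cfc_scalar_op: "cfc H g (scalar_op c) = scalar_op (g c)"
proof -
  let ?T = "scalar_op c"
  have cont: "continuous_on (spectrum H ?T) h" for h :: "complex \<Rightarrow> complex"
    using continuous_on_subset[OF _ spectrum_scalar_op] by simp
  have ex: "cfc_hom H ?T (\<lambda>h. scalar_op (h c))"
    unfolding cfc_hom_def Let_def
    by (auto simp: cont is_adjoint_def hinner_simps op_closures smult_laws
      intro!: op_eqI op_closures) (metis scalar_op_eq_on_spectrum bounded_ops_apply(2,4))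
  have "\<Phi> g = scalar_op (g c)" if \<Phi>: "cfc_hom H ?T \<Phi>" for \<Phi>
  proof -
    have cong: "\<Phi> h = \<Phi> h'" if "\<forall>z\<in>spectrum H ?T. h z = h' z" for h h'
      using \<Phi> that unfolding cfc_hom_def Let_def by (simp add: cont)
    have "\<forall>a. \<forall>h\<in>{h. continuous_on (spectrum H ?T) h}.
        \<Phi> (\<lambda>z. a * h z) = a \<odot>\<^bsub>\<B>\<^esub> \<Phi> h"
      using \<Phi> unfolding cfc_hom_def Let_def by (elim conjE) assumption
    hence smult: "\<Phi> (\<lambda>z. a * h z) = a \<odot>\<^bsub>\<B>\<^esub> \<Phi> h" for a h
      using cont by blast
    have "\<Phi> g = \<Phi> (\<lambda>z. g c * 1)"
      using spectrum_scalar_op[of c] by (intro cong) auto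
    also have "\<dots> = g c \<odot>\<^bsub>\<B>\<^esub> \<Phi> (\<lambda>z. 1)" by (rule smult)
    also have "\<Phi> (\<lambda>z. 1) = \<one>\<^bsub>\<B>\<^esub>" using \<Phi> unfolding cfc_hom_def Let_def by auto
    finally show ?thesis .
  qed
  thus ?thesis unfolding cfc_def using ex by (intro the_equality) (auto intro!: exI)
qed

end


section \<open>The operator order and values off the carrier\<close>

context complex_hilbert_space
begin

text \<open>
  Sums and differences of operators see only the values on the carrier. The order therefore makes
  sense of terms that are operators up to their values elsewhere, which is what is shown of
  \<open>f(T)\<close>.
\<close>

lemma a_inv_restrict: "\<ominus>\<^bsub>\<B>\<^esub> S = \<ominus>\<^bsub>\<B>\<^esub> (restrict S (carrier H))"
  by (simp add: a_inv_def m_inv_def bounded_ops_def cong: restrict_cong)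

lemma add_restrict:
  "S \<oplus>\<^bsub>\<B>\<^esub> T = restrict S (carrier H) \<oplus>\<^bsub>\<B>\<^esub> restrict T (carrier H)"
  by (simp add: bounded_ops_def cong: restrict_cong)

lemma op_le_restrict:
  "op_le H S T \<longleftrightarrow> op_le H (restrict S (carrier H)) (restrict T (carrier H))"
  unfolding op_le_def a_minus_def a_inv_restrict[of S]
  by (subst add_restrict) (simp add: bounded_ops_def cong: restrict_cong)

end


section \<open>A Hilbert space with a strict addition\<close>

context complex_hilbert_space
begin

text \<open>
  A sum that leaves the carrier as soon as one of the summands lies outside it, provided that the
  carrier is not the whole type. The strict space agrees with \<open>H\<close> on the carrier, so
  it is a Hilbert space with the same bounded operators, spectra and functional calculi.
\<close>

definition strict_add :: "'a \<Rightarrow> 'a \<Rightarrow> 'a" where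
  "strict_add x y =
     (if x \<in> carrier H \<and> y \<in> carrier H then x \<oplus> y else (SOME z. z \<notin> carrier H))"

definition strict_space :: "('a, 'm) hilbert_scheme" where
  "strict_space = H\<lparr>add := strict_add\<rparr>"

lemma strict_space_simps [simp]:
  "carrier strict_space = carrier H"
  "zero strict_space = \<zero>"
  "smult strict_space = smult H"
  "hinner strict_space = hinner H"
  "add strict_space = strict_add"
  by (simp_all add: strict_space_def)

lemma strict_add_eq [simp]: "x \<in> carrier H \<Longrightarrow> y \<in> carrier H \<Longrightarrow> strict_add x y = x \<oplus> y"
  by (simp add: strict_add_def)

lemma hnorm_strict_space [simp]: "hnorm strict_space x = hnorm H x"
  by (simp add: hnorm_def)

lemma abelian_group_strict_space: "abelian_group strict_space"
  by (intro abelian_groupI) (auto simp: M.a_ac intro: bexI[of _ "\<ominus> _"] M.l_neg)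

lemma strict_space_minus:
  assumes "x \<in> carrier H" "y \<in> carrier H"
  shows "x \<ominus>\<^bsub>strict_space\<^esub> y = x \<ominus> y"
proof -
  interpret S: abelian_group strict_space by (rule abelian_group_strict_space)
  have "\<ominus>\<^bsub>strict_space\<^esub> y = \<ominus> y"
    using assms by (intro S.minus_equality) (simp_all add: M.l_neg)
  thus ?thesis using assms by (simp add: a_minus_def)
qed

lemma complex_hilbert_space_strict_space: "complex_hilbert_space strict_space"
proof (intro complex_hilbert_space.intro complex_hilbert_space_axioms.intro)
  show "Module.module complex_ring strict_space"
    using R.cring_axioms abelian_group_strict_space
    by (rule moduleI) (simp_all add: smult_laws smult_r_distr)
  fix s :: "nat \<Rightarrow> 'a" assume s: "\<And>n. s n \<in> carrier strict_space"
    "\<And>e. e > 0 \<Longrightarrow>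
      \<exists>N. \<forall>m\<ge>N. \<forall>n\<ge>N. hnorm strict_space (s m \<ominus>\<^bsub>strict_space\<^esub> s n) < e"
  have "\<exists>x\<in>carrier H. (\<lambda>n. hnorm H (s n \<ominus> x)) \<longlonglongrightarrow> 0"
    using s by (intro complete) (simp_all add: strict_space_minus)
  thus "\<exists>x\<in>carrier strict_space.
      (\<lambda>n. hnorm strict_space (s n \<ominus>\<^bsub>strict_space\<^esub> x)) \<longlonglongrightarrow> 0"
    using s by (simp add: strict_space_minus cong: bex_cong)
qed (simp_all add: hinner_simps hinner_nonneg hinner_definite hinner_commute[symmetric])

lemma bounded_ops_strict_space [simp]:
  "carrier (bounded_ops strict_space) = carrier \<B>"
  "mult (bounded_ops strict_space) = mult \<B>"
  "one (bounded_ops strict_space) = one \<B>"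
  "zero (bounded_ops strict_space) = zero \<B>"
  "smult (bounded_ops strict_space) = smult \<B>"
proof -
  have "bounded_op strict_space T \<longleftrightarrow> bounded_op H T" for T
    unfolding bounded_op_def
    by (intro conj_cong refl ball_cong) (auto simp: PiE_iff)
  thus "carrier (bounded_ops strict_space) = carrier \<B>" by (simp add: bounded_ops_def)
qed (simp_all add: bounded_ops_def)

lemma add_op_strict_space [simp]:
  "S \<in> carrier \<B> \<Longrightarrow> T \<in> carrier \<B> \<Longrightarrow> S \<oplus>\<^bsub>bounded_ops strict_space\<^esub> T = S \<oplus>\<^bsub>\<B>\<^esub> T"
  using op_closed[of S] op_closed[of T]
  by (auto simp: bounded_ops_def simp del: op_closed cong: restrict_cong)

lemma minus_op_strict_space:
  assumes "S \<in> carrier \<B>" "T \<in> carrier \<B>"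
  shows "S \<ominus>\<^bsub>bounded_ops strict_space\<^esub> T = S \<ominus>\<^bsub>\<B>\<^esub> T"
proof -
  interpret S: complex_hilbert_space strict_space by (rule complex_hilbert_space_strict_space)
  have "\<ominus>\<^bsub>bounded_ops strict_space\<^esub> T = \<ominus>\<^bsub>\<B>\<^esub> T"
    using assms by (intro S.Ops.minus_equality) (simp_all add: Ops.l_neg)
  thus ?thesis using assms by (simp add: a_minus_def)
qed

lemma spectrum_strict_space: "T \<in> carrier \<B> \<Longrightarrow> spectrum strict_space T = spectrum H T"
  by (simp add: spectrum_def scalar_minus_def minus_op_strict_space op_closures Units_def)

lemma is_adjoint_strict_space: "is_adjoint strict_space = is_adjoint H"
  by (simp add: is_adjoint_def fun_eq_iff)

text \<open>
  The two additions of operators agree on bounded operators only. If \<open>\<Phi>\<close> takes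
  other values, it is a functional calculus on neither space.
\<close>

lemma real_cfc_strict_space:
  assumes "T \<in> carrier \<B>"
  shows "real_cfc strict_space f T = real_cfc H f T"
proof -
  have "cfc_hom strict_space T \<Phi> \<longleftrightarrow> cfc_hom H T \<Phi>" for \<Phi>
  proof (cases "\<forall>g\<in>{g. continuous_on (spectrum H T) g}. \<Phi> g \<in> carrier \<B>")
    case True
    hence "\<Phi> g \<oplus>\<^bsub>bounded_ops strict_space\<^esub> \<Phi> h = \<Phi> g \<oplus>\<^bsub>\<B>\<^esub> \<Phi> h"
      if "g \<in> {g. continuous_on (spectrum H T) g}" "h \<in> {g. continuous_on (spectrum H T) g}"
      for g h
      using that by (intro add_op_strict_space) blast+
    thus ?thesis
      unfolding cfc_hom_def Let_def spectrum_strict_space[OF assms] is_adjoint_strict_space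
        bounded_ops_strict_space
      by (intro conj_cong ball_cong refl) (simp only:)
  next
    case False
    thus ?thesis
      unfolding cfc_hom_def Let_def spectrum_strict_space[OF assms] bounded_ops_strict_space
      by (simp only: simp_thms)
  qed
  thus ?thesis by (simp add: real_cfc_def cfc_def)
qed

text \<open>
  The order in the strict space forces \<open>S\<close> to map the carrier into itself: otherwise
  \<open>S - W\<close> would take a value outside the carrier. Then \<open>S\<close> is the sum of
  \<open>S - W\<close> and \<open>W\<close> on the carrier.
\<close>

lemma op_le_strict_space_imp_bounded:
  assumes W: "W \<in> carrier \<B>" and le: "op_le strict_space W S"
  shows "restrict S (carrier H) \<in> carrier \<B>"
proof -
  interpret S: complex_hilbert_space strict_space by (rule complex_hilbert_space_strict_space)
  define R where "R = S \<ominus>\<^bsub>bounded_ops strict_space\<^esub> W"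
  have R: "R \<in> carrier \<B>" using le by (simp add: R_def op_le_def S.positive_op_iff)
  have S: "S x = R x \<oplus> W x" if x: "x \<in> carrier H" for x
  proof -
    have Rx: "R x = strict_add (S x) (\<ominus>\<^bsub>strict_space\<^esub> W x)"
      using W x S.diff_op_apply[of W x S] by (simp add: R_def S.M.minus_eq)
    have Sx: "S x \<in> carrier H"
    proof (rule ccontr)
      assume "S x \<notin> carrier H"
      hence "R x = (SOME z. z \<notin> carrier H)" by (simp add: Rx strict_add_def)
      moreover have "(SOME z. z \<notin> carrier H) \<notin> carrier H"
        using \<open>S x \<notin> carrier H\<close> by (rule someI)
      ultimately show False using op_closed[OF R x] by simp
    qed
    have "R x = S x \<ominus> W x"
      using Sx W x strict_space_minus[of "S x" "W x"] by (simp add: Rx S.M.minus_eq)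
    thus ?thesis using Sx W x by (simp add: M.minus_eq M.a_assoc M.l_neg)
  qed
  have "restrict S (carrier H) = R \<oplus>\<^bsub>\<B>\<^esub> W"
    using S by (simp add: bounded_ops_def cong: restrict_cong)
  thus ?thesis using R W by (simp add: op_closures)
qed

end


section \<open>Operator monotone functions on the negative half-line\<close>

lemma operator_monotoneD:
  fixes H :: "'a hilbert"
  assumes H: "complex_hilbert_space H" and f: "operator_monotone TYPE('a) {..<0} f"
    and S: "complex_hilbert_space.strictly_negative H S"
    and T: "complex_hilbert_space.strictly_negative H T"
    and le: "op_le H S T"
  shows "op_le H (real_cfc H f S) (real_cfc H f T)"
proof -
  interpret complex_hilbert_space H by (rule H)
  show ?thesis
    using f H le strictly_negative_imp_self_adjoint[OF S] strictly_negative_imp_self_adjoint[OF T]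
      strictly_negative_spectrum[OF S] strictly_negative_spectrum[OF T]
    unfolding operator_monotone_def by blast
qed

text \<open>
  Monotonicity applied to \<open>t I \<le> T\<close>, in the strict space for boundedness of
  \<open>f(T)\<close> and in \<open>H\<close> for the inequality.
\<close>

lemma real_cfc_lower_bound:
  fixes H :: "'a hilbert"
  assumes H: "complex_hilbert_space H" and f: "operator_monotone TYPE('a) {..<0} f"
    and T: "complex_hilbert_space.strictly_negative H T"
  obtains t where "t < 0" "restrict (real_cfc H f T) (carrier H) \<in> carrier (bounded_ops H)"
    "op_le H (complex_of_real (f t) \<odot>\<^bsub>bounded_ops H\<^esub> \<one>\<^bsub>bounded_ops H\<^esub>) (real_cfc H f T)"
proof -
  interpret complex_hilbert_space H by (rule H)
  interpret S: complex_hilbert_space strict_space by (rule complex_hilbert_space_strict_space)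
  have Tc: "T \<in> carrier \<B>" using T by (rule strictly_negative_imp_closed)
  obtain t where t: "t < 0" "op_le H (scalar_op (complex_of_real t)) T"
    using ex_scalar_op_le[OF T] by blast
  have f_scalar: "real_cfc H f (scalar_op (complex_of_real t)) = scalar_op (complex_of_real (f t))"
    by (simp add: real_cfc_def cfc_scalar_op)
  have tn: "strictly_negative (scalar_op (complex_of_real t))"
    using t(1) by (rule strictly_negative_scalar_op)
  have sn: "S.strictly_negative U" if "strictly_negative U" for U
    using that by (simp add: strictly_negative_def S.strictly_negative_def)
  have "op_le strict_space (scalar_op (complex_of_real t)) T"
    using t(2) Tc by (simp add: op_le_iff S.op_le_iff op_closures)
  hence "op_le strict_space (scalar_op (complex_of_real (f t))) (real_cfc H f T)"
    using operator_monotoneD[OF S.complex_hilbert_space_axioms f sn[OF tn] sn[OF T]]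
    by (simp add: real_cfc_strict_space Tc op_closures f_scalar)
  hence "restrict (real_cfc H f T) (carrier H) \<in> carrier \<B>"
    by (rule op_le_strict_space_imp_bounded[rotated]) (simp add: op_closures)
  moreover have "op_le H (scalar_op (complex_of_real (f t))) (real_cfc H f T)"
    using operator_monotoneD[OF H f tn T t(2)] by (simp add: f_scalar)
  ultimately show ?thesis using t(1) by (intro that)
qed

text \<open>
  \<open>f(A + B) \<le> f(A) \<le> f(A) + f(B)\<close>. The operators \<open>P\<close>,
  \<open>Q\<close>, \<open>R\<close> below are the restrictions of \<open>f(A)\<close>,
  \<open>f(B)\<close>, \<open>f(A + B)\<close> to the carrier.
\<close>

lemma real_cfc_add_le:
  fixes H :: "'a hilbert"
  assumes H: "complex_hilbert_space H" and f: "operator_monotone TYPE('a) {..<0} f"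
    and pos: "\<forall>t<0. f t > 0"
    and A: "complex_hilbert_space.strictly_negative H A"
    and B: "complex_hilbert_space.strictly_negative H B"
  shows "op_le H (real_cfc H f (A \<oplus>\<^bsub>bounded_ops H\<^esub> B))
                 (real_cfc H f A \<oplus>\<^bsub>bounded_ops H\<^esub> real_cfc H f B)"
proof -
  interpret complex_hilbert_space H by (rule H)
  note AB = strictly_negative_add[OF A B]
  define P Q R where
    "P = restrict (real_cfc H f A) (carrier H)" and
    "Q = restrict (real_cfc H f B) (carrier H)" and
    "R = restrict (real_cfc H f (A \<oplus>\<^bsub>\<B>\<^esub> B)) (carrier H)"
  have P: "P \<in> carrier \<B>" using real_cfc_lower_bound[OF H f A] unfolding P_def by blast
  have R: "R \<in> carrier \<B>" using real_cfc_lower_bound[OF H f AB] unfolding R_def by blast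
  obtain t where t: "t < 0" "Q \<in> carrier \<B>"
      "op_le H (scalar_op (complex_of_real (f t))) (real_cfc H f B)"
    using real_cfc_lower_bound[OF H f B] unfolding Q_def by blast
  have Ac: "A \<in> carrier \<B>" and Bc: "B \<in> carrier \<B>"
    using A B by (auto dest: strictly_negative_imp_closed)
  have "op_le H (A \<oplus>\<^bsub>\<B>\<^esub> B) A"
  proof -
    have "- hinner H (B x) x \<in> \<real>\<^sub>\<ge>\<^sub>0" if x: "x \<in> carrier H" for x
    proof -
      obtain d where d: "d > 0" "Im (hinner H (B x) x) = 0"
        "Re (hinner H (B x) x) \<le> - d * (hnorm H x)\<^sup>2"
        using strictly_negativeE[OF B] x by metis
      have "- d * (hnorm H x)\<^sup>2 \<le> 0" using d(1) by simp
      thus ?thesis using d(2,3) by (simp add: complex_nonneg_Reals_iff)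
    qed
    thus ?thesis using Ac Bc by (simp add: op_le_iff op_closures hinner_simps)
  qed
  hence "op_le H R P"
    using operator_monotoneD[OF H f AB A] op_le_restrict unfolding P_def R_def by blast
  hence 1: "hinner H (P x) x - hinner H (R x) x \<in> \<real>\<^sub>\<ge>\<^sub>0" if "x \<in> carrier H" for x
    using that P R by (simp add: op_le_iff)
  have 2: "hinner H (Q x) x \<in> \<real>\<^sub>\<ge>\<^sub>0" if x: "x \<in> carrier H" for x
  proof -
    have eq: "restrict (scalar_op (complex_of_real (f t))) (carrier H) =
        scalar_op (complex_of_real (f t))"
      by (simp add: bounded_ops_def)
    have "op_le H (scalar_op (complex_of_real (f t))) Q"
      using t(3) op_le_restrict[of "scalar_op (complex_of_real (f t))" "real_cfc H f B"]
      by (simp only: eq Q_def)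
    hence "hinner H (Q x) x - complex_of_real (f t) * complex_of_real ((hnorm H x)\<^sup>2) \<in> \<real>\<^sub>\<ge>\<^sub>0"
      using t(2) x by (simp add: op_le_iff op_closures hinner_simps hinner_self)
    moreover have "0 \<le> f t * (hnorm H x)\<^sup>2" using pos t(1) by (simp add: less_imp_le)
    ultimately show ?thesis by (auto simp: complex_nonneg_Reals_iff simp del: of_real_power)
  qed
  have "op_le H R (P \<oplus>\<^bsub>\<B>\<^esub> Q)"
    unfolding op_le_iff[OF R add_op_closed[OF P t(2)]]
  proof
    fix x assume x: "x \<in> carrier H"
    have "hinner H (P x) x - hinner H (R x) x + hinner H (Q x) x \<in> \<real>\<^sub>\<ge>\<^sub>0"
      using 1[OF x] 2[OF x] by (rule nonneg_Reals_add_I)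
    thus "hinner H ((P \<oplus>\<^bsub>\<B>\<^esub> Q) x) x - hinner H (R x) x \<in> \<real>\<^sub>\<ge>\<^sub>0"
      using x P t(2) by (simp add: hinner_simps algebra_simps)
  qed
  moreover have "restrict (real_cfc H f A \<oplus>\<^bsub>\<B>\<^esub> real_cfc H f B) (carrier H) = P \<oplus>\<^bsub>\<B>\<^esub> Q"
    by (simp add: bounded_ops_def P_def Q_def cong: restrict_cong)
  ultimately show ?thesis
    using op_le_restrict[of "real_cfc H f (A \<oplus>\<^bsub>\<B>\<^esub> B)" "real_cfc H f A \<oplus>\<^bsub>\<B>\<^esub> real_cfc H f B"]
    by (simp only: R_def)
qed

theorem corollary2p6:
  fixes H :: "'a hilbert" and f :: "real \<Rightarrow> real" and A B :: "'a \<Rightarrow> 'a"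
  assumes "complex_hilbert_space H"
    and "operator_monotone TYPE('a) {..<0} f"
    and "\<forall>t<0. f t > 0"
    and "negative_op H A" and "A \<in> Units (bounded_ops H)"
    and "negative_op H B" and "B \<in> Units (bounded_ops H)"
  shows "op_le H (real_cfc H f (A \<oplus>\<^bsub>bounded_ops H\<^esub> B))
                 (real_cfc H f A \<oplus>\<^bsub>bounded_ops H\<^esub> real_cfc H f B)
    \<longleftrightarrow>
    (\<forall>l::real. 0 \<le> l \<longrightarrow>
       positive_op H
         ((A \<otimes>\<^bsub>bounded_ops H\<^esub> inv\<^bsub>bounded_ops H\<^esub> (scalar_minus H (complex_of_real l) B)
             \<otimes>\<^bsub>bounded_ops H\<^esub> A)
          \<oplus>\<^bsub>bounded_ops H\<^esub>
          (B \<otimes>\<^bsub>bounded_ops H\<^esub> inv\<^bsub>bounded_ops H\<^esub> (scalar_minus H (complex_of_real l) A)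
             \<otimes>\<^bsub>bounded_ops H\<^esub> B)))"
proof -
  interpret complex_hilbert_space H by fact
  have A: "strictly_negative A" and B: "strictly_negative B"
    using assms by (auto intro: negative_unit_imp_strictly_negative)
  have "positive_op H (S \<oplus>\<^bsub>\<B>\<^esub> T)" if "positive_op H S" "positive_op H T" for S T
    using that by (auto simp: positive_op_iff op_closures hinner_simps)
  thus ?thesis
    using real_cfc_add_le[OF assms(1-3) A B] A B
    by (auto intro!: positive_sandwich_resolvent strictly_negative_imp_self_adjoint)
qed

end
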